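(* Let $\mu_1,\mu_2>0$, $q>0$, and let $a>1$, $b>1$, $c\ge0$ satisfy $(a-1)(b-1)\ge(c-1)^2$. Suppose that $Q_b<q$ and $Q_b\le-\zeta_b$. Then an optimal distribution for the problem $$v_P(q;\theta)=\sup_{\mathbb P\in\mathcal F(\theta)}\mathbb E_{\mathbb P}[(X_1+X_2-q)_+]$$ is the one taking the value $(q-Q_b,0)$ with probability $p_1=\frac{b-1}{2b}+\frac{q(b-1)+\mu_1(c-b)}{2bQ_b}$, the value $(q+Q_b,0)$ with probability $p_2=\frac{b-1}{2b}-\frac{q(b-1)+\mu_1(c-b)}{2bQ_b}$, and the value $(c\mu_1,b\mu_2)$ with probability $p_3=\frac1b$. The optimal value is $$v_P(q;\theta)=\frac{b-1}{2b}\left(\frac{b-c}{b-1}\mu_1-(q-Q_b)\right).$$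
   Context: $(t)_+=\max\{t,0\}$. $\theta=(\mu_1,\mu_2,a\mu_1^2,b\mu_2^2,c\mu_1\mu_2)$, and $\mathcal F(\theta)$ is the set of all probability distributions $\mathbb P$ of a random vector $(X_1,X_2)$ supported on $\mathbb R_+^2=[0,\infty)^2$ such that $\mathbb E_{\mathbb P}[X_1]=\mu_1$, $\mathbb E_{\mathbb P}[X_2]=\mu_2$, $\mathbb E_{\mathbb P}[X_1^2]=a\mu_1^2$, $\mathbb E_{\mathbb P}[X_2^2]=b\mu_2^2$, $\mathbb E_{\mathbb P}[X_1X_2]=c\mu_1\mu_2$. "Optimal distribution" means a distribution belonging to $\mathcal F(\theta)$ at which the supremum is attained. Notation: $$Q_b=\sqrt{q^2-2q\tfrac{b-c}{b-1}\mu_1+\tfrac{ab-c^2}{b-1}\mu_1^2},\qquad \zeta_b=c\mu_1+b\mu_2-q.$$ *)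

theory Defs
  imports "HOL-Probability.Probability"
begin

text \<open>A law with support in the closed quadrant is a Borel probability measure on the whole plane
  that is concentrated on the quadrant. The tuple lists, in this order, the prescribed values of
  \<open>E[X1]\<close>, \<open>E[X2]\<close>, \<open>E[X1^2]\<close>, \<open>E[X2^2]\<close> and \<open>E[X1 X2]\<close>; finiteness of these moments is part of
  \<^const>\<open>has_bochner_integral\<close>.\<close>

definition moment_class :: "real \<times> real \<times> real \<times> real \<times> real \<Rightarrow> (real \<times> real) measure set" where
  "moment_class \<theta> = (case \<theta> of (m1, m2, s1, s2, s12) \<Rightarrow>
     {P. prob_space P \<and> sets P = sets borel \<and>
         (AE x in P. 0 \<le> fst x \<and> 0 \<le> snd x) \<and>
         has_bochner_integral P (\<lambda>x. fst x) m1 \<and>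
         has_bochner_integral P (\<lambda>x. snd x) m2 \<and>
         has_bochner_integral P (\<lambda>x. (fst x)\<^sup>2) s1 \<and>
         has_bochner_integral P (\<lambda>x. (snd x)\<^sup>2) s2 \<and>
         has_bochner_integral P (\<lambda>x. fst x * snd x) s12})"

definition theta :: "real \<Rightarrow> real \<Rightarrow> real \<Rightarrow> real \<Rightarrow> real \<Rightarrow> real \<times> real \<times> real \<times> real \<times> real" where
  "theta \<mu>1 \<mu>2 a b c = (\<mu>1, \<mu>2, a * \<mu>1\<^sup>2, b * \<mu>2\<^sup>2, c * \<mu>1 * \<mu>2)"

definition expected_payoff :: "real \<Rightarrow> (real \<times> real) measure \<Rightarrow> real" where
  "expected_payoff q P = (\<integral>x. max (fst x + snd x - q) 0 \<partial>P)"

text \<open>The supremum is taken in the extended reals, so that no boundedness is presupposed.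
  On \<^const>\<open>moment_class\<close> the payoff is integrable, being dominated by a constant plus \<open>|X1| + |X2|\<close>.\<close>

definition v_P :: "real \<Rightarrow> real \<times> real \<times> real \<times> real \<times> real \<Rightarrow> ereal" where
  "v_P q \<theta> = (SUP P\<in>moment_class \<theta>. ereal (expected_payoff q P))"

definition optimal_distribution ::
  "real \<Rightarrow> real \<times> real \<times> real \<times> real \<times> real \<Rightarrow> (real \<times> real) measure \<Rightarrow> bool" where
  "optimal_distribution q \<theta> P \<longleftrightarrow> P \<in> moment_class \<theta> \<and> ereal (expected_payoff q P) = v_P q \<theta>"

definition Q_b :: "real \<Rightarrow> real \<Rightarrow> real \<Rightarrow> real \<Rightarrow> real \<Rightarrow> real" where
  "Q_b q \<mu>1 a b c =
     sqrt (q\<^sup>2 - 2 * q * ((b - c) / (b - 1)) * \<mu>1 + ((a * b - c\<^sup>2) / (b - 1)) * \<mu>1\<^sup>2)"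

definition zeta_b :: "real \<Rightarrow> real \<Rightarrow> real \<Rightarrow> real \<Rightarrow> real \<Rightarrow> real" where
  "zeta_b q \<mu>1 \<mu>2 b c = c * \<mu>1 + b * \<mu>2 - q"

text \<open>The Borel law of a finite list of (value, probability) pairs; probabilities of repeated
  values add up. It is meaningful only if \<^const>\<open>pmf_of_list_wf\<close> holds for the list, that is, if
  the weights are nonnegative and sum to 1.\<close>

definition finite_law :: "((real \<times> real) \<times> real) list \<Rightarrow> (real \<times> real) measure" where
  "finite_law xs = distr (measure_pmf (pmf_of_list xs)) borel (\<lambda>x. x)"

text \<open>If \<open>Q_b = 0\<close>, the two fractions with denominator \<open>2 * b * Q_b\<close> have, under the hypotheses
  \<open>b > 1\<close> and \<open>(a - 1) * (b - 1) \<ge> (c - 1)^2\<close>, also numerator 0. The convention \<open>x / 0 = 0\<close> then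
  puts total mass \<open>(b - 1) / b\<close> on the single point \<open>(q, 0)\<close>.\<close>

definition three_point_atoms ::
  "real \<Rightarrow> real \<Rightarrow> real \<Rightarrow> real \<Rightarrow> real \<Rightarrow> real \<Rightarrow> ((real \<times> real) \<times> real) list" where
  "three_point_atoms q \<mu>1 \<mu>2 a b c =
    (let Q = Q_b q \<mu>1 a b c in
     [((q - Q, 0), (b - 1) / (2 * b) + (q * (b - 1) + \<mu>1 * (c - b)) / (2 * b * Q)),
      ((q + Q, 0), (b - 1) / (2 * b) - (q * (b - 1) + \<mu>1 * (c - b)) / (2 * b * Q)),
      ((c * \<mu>1, b * \<mu>2), 1 / b)])"

end

theory Submission
  imports Defs
begin

text \<open>
  Put \<open>Q = Q_b\<close>, \<open>\<kappa> = (q - Q - c \<mu>1) / (b \<mu>2)\<close> and \<open>Z = X1 + \<kappa> X2 - q\<close>. The hypothesis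
  \<open>Q \<le> - \<zeta>_b\<close> says exactly that \<open>\<kappa> \<ge> 1\<close>, so on the quadrant the payoff is at most
  \<open>max Z 0 = (Z + \<bar>Z\<bar>) / 2\<close>. The prescribed moments give \<open>E[Z\<^sup>2] = Q\<^sup>2\<close>, hence \<open>E\<bar>Z\<bar> \<le> Q\<close>, and
  \<open>(E[Z] + Q) / 2\<close> is the claimed value. The three atoms are points with \<open>\<bar>Z\<bar> = Q\<close> where the payoff
  is \<open>max Z 0\<close>, so nothing is lost. No division by \<open>Q\<close> occurs in the bound, so the degenerate case
  \<open>Q = 0\<close> is covered.
\<close>

text \<open>Each list entry feeds exactly one term of the outer sum, whence the induction. Repeated
  values are allowed on purpose: when \<open>Q_b\<close> vanishes, the first two atoms of the
  three-point law coincide.\<close>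

lemma sum_pmf_of_list:
  fixes f :: "'a \<Rightarrow> real"
  assumes "finite A" "fst ` set xs \<subseteq> A"
  shows "(\<Sum>x\<in>A. f x * sum_list (map snd (filter (\<lambda>z. fst z = x) xs))) = (\<Sum>(x, p)\<leftarrow>xs. f x * p)"
  using assms(2)
proof (induction xs)
  case (Cons y ys)
  obtain x p where y: "y = (x, p)" by force
  have "(\<Sum>z\<in>A. f z * sum_list (map snd (filter (\<lambda>w. fst w = z) (y # ys)))) =
      (\<Sum>z\<in>A. (if z = x then f z * p else 0)
        + f z * sum_list (map snd (filter (\<lambda>w. fst w = z) ys)))"
    by (intro sum.cong) (auto simp: y algebra_simps)
  also have "\<dots> = f x * p + (\<Sum>(x, p)\<leftarrow>ys. f x * p)"
    using Cons assms(1) by (simp add: sum.distrib y)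
  finally show ?case by (simp add: y)
qed simp

text \<open>Finite support makes every function integrable under the pmf; measurability of
  \<open>f\<close> enters when the integral is carried over to the Borel image.\<close>

lemma has_bochner_integral_finite_law:
  fixes f :: "real \<times> real \<Rightarrow> real"
  assumes wf: "pmf_of_list_wf xs" and f: "f \<in> borel_measurable borel"
  shows "has_bochner_integral (finite_law xs) f (\<Sum>(x, p)\<leftarrow>xs. f x * p)"
proof -
  have sub: "set_pmf (pmf_of_list xs) \<subseteq> fst ` set xs"
    using set_pmf_of_list[OF wf] by force
  have int: "integrable (measure_pmf (pmf_of_list xs)) f"
    by (rule integrable_measure_pmf_finite) (use sub finite_subset in blast)
  have "(\<integral>x. f x \<partial>measure_pmf (pmf_of_list xs)) =
      (\<Sum>x\<in>fst ` set xs. f x * pmf (pmf_of_list xs) x)"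
    by (rule integral_measure_pmf_real) (use sub in auto)
  also have "\<dots> = (\<Sum>(x, p)\<leftarrow>xs. f x * p)"
    by (simp add: pmf_pmf_of_list[OF wf] sum_pmf_of_list)
  finally have "has_bochner_integral (measure_pmf (pmf_of_list xs)) f (\<Sum>(x, p)\<leftarrow>xs. f x * p)"
    using int by (simp add: has_bochner_integral_iff)
  then show ?thesis
    unfolding finite_law_def has_bochner_integral_iff
    using f by (simp add: integrable_distr_eq integral_distr)
qed

lemma AE_finite_law:
  assumes wf: "pmf_of_list_wf xs" and "\<And>x. x \<in> fst ` set xs \<Longrightarrow> R x"
    and "{x. R x} \<in> sets borel"
  shows "AE x in finite_law xs. R x"
proof -
  have "AE x in measure_pmf (pmf_of_list xs). R x"
    using set_pmf_of_list[OF wf] assms(2) by (force simp: AE_measure_pmf_iff)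
  then show ?thesis
    unfolding finite_law_def using assms(3) by (subst AE_distr_iff) auto
qed

lemma prob_space_finite_law: "prob_space (finite_law xs)"
  unfolding finite_law_def
  by (rule prob_space.prob_space_distr) (auto intro: measure_pmf.prob_space_axioms)

lemma sets_finite_law: "sets (finite_law xs) = sets borel"
  by (simp add: finite_law_def)

text \<open>The variance of \<open>|Z|\<close> is nonnegative, and the square of \<open>|Z|\<close>
  is that of \<open>Z\<close>.\<close>

lemma (in prob_space) expectation_abs_le_sqrt:
  fixes Z :: "'a \<Rightarrow> real"
  assumes "integrable M Z" "integrable M (\<lambda>x. (Z x)\<^sup>2)"
  shows "expectation (\<lambda>x. \<bar>Z x\<bar>) \<le> sqrt (expectation (\<lambda>x. (Z x)\<^sup>2))"
  using variance_eq[of "\<lambda>x. \<bar>Z x\<bar>"] variance_positive[of "\<lambda>x. \<bar>Z x\<bar>"] assms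
  by (intro real_le_rsqrt) simp

text \<open>The radicand is E[Z^2] for \<open>Z = X1 + \<kappa> X2 - q\<close>, so the right side is
  the same for all \<open>P\<close> in the class. The slope stays free here; the theorem picks
  it.\<close>

lemma expected_payoff_le:
  assumes P: "P \<in> moment_class (m1, m2, s1, s2, s12)" and \<kappa>: "\<kappa> \<ge> 1"
  shows "expected_payoff q P \<le>
    (m1 + \<kappa> * m2 - q + sqrt (s1 + \<kappa>\<^sup>2 * s2 + 2 * \<kappa> * s12 - 2 * q * (m1 + \<kappa> * m2) + q\<^sup>2)) / 2"
proof -
  interpret prob_space P
    using P by (simp add: moment_class_def)
  define Z where "Z x = fst x + \<kappa> * snd x - q" for x :: "real \<times> real"
  have AE: "AE x in P. 0 \<le> fst x \<and> 0 \<le> snd x"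
    and sets: "sets P = sets borel"
    and [simp]: "integrable P fst" "integrable P snd" "integrable P (\<lambda>x. (fst x)\<^sup>2)"
      "integrable P (\<lambda>x. (snd x)\<^sup>2)" "integrable P (\<lambda>x. fst x * snd x)"
    and [simp]: "(\<integral>x. fst x \<partial>P) = m1" "(\<integral>x. snd x \<partial>P) = m2" "(\<integral>x. (fst x)\<^sup>2 \<partial>P) = s1"
      "(\<integral>x. (snd x)\<^sup>2 \<partial>P) = s2" "(\<integral>x. fst x * snd x \<partial>P) = s12"
    using P by (auto simp: moment_class_def has_bochner_integral_iff)
  have Z_int: "integrable P Z" and EZ: "(\<integral>x. Z x \<partial>P) = m1 + \<kappa> * m2 - q"
    by (simp_all add: Z_def[abs_def] prob_space)
  \<comment> \<open>The square is spread over the monomials with known integrals, so that linearity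
    gives both integrability and value.\<close>
  have Z2: "(Z x)\<^sup>2 = (fst x)\<^sup>2 + \<kappa>\<^sup>2 * (snd x)\<^sup>2 + 2 * \<kappa> * (fst x * snd x)
      - 2 * q * (fst x + \<kappa> * snd x) + q\<^sup>2" for x
    by (simp add: Z_def power2_eq_square algebra_simps)
  have Z2_int: "integrable P (\<lambda>x. (Z x)\<^sup>2)"
    and EZ2: "(\<integral>x. (Z x)\<^sup>2 \<partial>P) =
      s1 + \<kappa>\<^sup>2 * s2 + 2 * \<kappa> * s12 - 2 * q * (m1 + \<kappa> * m2) + q\<^sup>2"
    by (simp_all add: Z2 prob_space)
  have "expected_payoff q P \<le> (\<integral>x. (Z x + \<bar>Z x\<bar>) / 2 \<partial>P)"
    unfolding expected_payoff_def
  proof (rule integral_mono_AE)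
    show "AE x in P. max (fst x + snd x - q) 0 \<le> (Z x + \<bar>Z x\<bar>) / 2"
      using AE
    proof eventually_elim
      case (elim x)
      then have "snd x \<le> \<kappa> * snd x"
        using \<kappa> mult_right_mono[of 1 \<kappa> "snd x"] by simp
      then show ?case by (auto simp: Z_def max_def abs_if)
    qed
    show "integrable P (\<lambda>x. max (fst x + snd x - q) 0)" by simp
    show "integrable P (\<lambda>x. (Z x + \<bar>Z x\<bar>) / 2)" using Z_int by simp
  qed
  also have "\<dots> = ((\<integral>x. Z x \<partial>P) + (\<integral>x. \<bar>Z x\<bar> \<partial>P)) / 2"
    using Z_int by simp
  also have "\<dots> \<le> ((\<integral>x. Z x \<partial>P) + sqrt (\<integral>x. (Z x)\<^sup>2 \<partial>P)) / 2"
    using expectation_abs_le_sqrt[OF Z_int Z2_int] by simp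
  finally show ?thesis unfolding EZ EZ2 .
qed

text \<open>Completing the square in \<open>q\<close> leaves a remainder that is nonnegative by the
  condition on \<open>a\<close>, \<open>b\<close>, \<open>c\<close>. So the radicand is nonnegative
  and \<open>sqrt\<close> can be undone; dropping the remainder gives the second bound, which later
  keeps the weights nonnegative.\<close>

lemma Q_b_power2:
  fixes \<mu>1 q a b c :: real
  assumes "b > 1" "(a - 1) * (b - 1) \<ge> (c - 1)\<^sup>2"
  shows "(Q_b q \<mu>1 a b c)\<^sup>2
      = q\<^sup>2 - 2 * q * ((b - c) / (b - 1)) * \<mu>1 + ((a * b - c\<^sup>2) / (b - 1)) * \<mu>1\<^sup>2" (is "_ = ?R")
    and "\<bar>q - (b - c) / (b - 1) * \<mu>1\<bar> \<le> Q_b q \<mu>1 a b c"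
proof -
  have "?R = (q - (b - c) / (b - 1) * \<mu>1)\<^sup>2
      + b * ((a - 1) * (b - 1) - (c - 1)\<^sup>2) * (\<mu>1 / (b - 1))\<^sup>2"
  proof -
    \<comment> \<open>A variable in place of \<open>b - 1\<close> turns the denominators into
      monomials before they are cleared.\<close>
    define t where "t = b - 1"
    then have "b = t + 1" "t > 0" using assms(1) by auto
    then show ?thesis by (simp add: divide_simps) (simp add: power2_eq_square algebra_simps)
  qed
  then have R: "(q - (b - c) / (b - 1) * \<mu>1)\<^sup>2 \<le> ?R"
    using assms by simp
  then show "\<bar>q - (b - c) / (b - 1) * \<mu>1\<bar> \<le> Q_b q \<mu>1 a b c"
    unfolding Q_b_def by (intro real_le_rsqrt) simp
  show "(Q_b q \<mu>1 a b c)\<^sup>2 = ?R"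
    unfolding Q_b_def using R by (intro real_sqrt_pow2) (rule order_trans[OF zero_le_power2])
qed

theorem lemmaB2p4:
  fixes \<mu>1 \<mu>2 q a b c :: real
  assumes "\<mu>1 > 0" and "\<mu>2 > 0" and "q > 0"
    and "a > 1" and "b > 1" and "c \<ge> 0"
    and "(a - 1) * (b - 1) \<ge> (c - 1)\<^sup>2"
    and "Q_b q \<mu>1 a b c < q"
    and "Q_b q \<mu>1 a b c \<le> - zeta_b q \<mu>1 \<mu>2 b c"
  shows "pmf_of_list_wf (three_point_atoms q \<mu>1 \<mu>2 a b c) \<and>
    optimal_distribution q (theta \<mu>1 \<mu>2 a b c) (finite_law (three_point_atoms q \<mu>1 \<mu>2 a b c)) \<and>
    v_P q (theta \<mu>1 \<mu>2 a b c) =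
      ereal ((b - 1) / (2 * b) * ((b - c) / (b - 1) * \<mu>1 - (q - Q_b q \<mu>1 a b c)))"
proof -
  define Q where "Q = Q_b q \<mu>1 a b c"
  \<comment> \<open>Under the three-point law, \<open>m\<close> is the mass of the axis
    \<open>X2 = 0\<close> and \<open>D\<close> is \<open>q\<close> minus the mean of
    \<open>X1\<close> given that axis. Given the axis, \<open>q - Q\<close> and \<open>q + Q\<close>
    have weights \<open>(1 + r) / 2\<close> and \<open>(1 - r) / 2\<close>.\<close>
  define m where "m = (b - 1) / b"
  define D where "D = q - (b - c) / (b - 1) * \<mu>1"
  define r where "r = D / Q"
  define xs where "xs = three_point_atoms q \<mu>1 \<mu>2 a b c"
  define v where "v = m / 2 * (Q - D)"
  have DQ: "\<bar>D\<bar> \<le> Q"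
    and Q2: "Q\<^sup>2 = q\<^sup>2 - 2 * q * ((b - c) / (b - 1)) * \<mu>1 + ((a * b - c\<^sup>2) / (b - 1)) * \<mu>1\<^sup>2"
    unfolding D_def Q_def using Q_b_power2 assms by auto
  then have Q0: "0 \<le> Q" by linarith
  \<comment> \<open>If \<open>Q = 0\<close>, then \<open>DQ\<close> forces \<open>D = 0\<close>, so
    the first equation survives the convention \<open>D / 0 = 0\<close>.\<close>
  have rQ: "r * Q = D" and r: "\<bar>r\<bar> \<le> 1"
    using DQ Q0 by (auto simp: r_def abs_divide divide_le_eq)
  have m: "m > 0" "1 / b = 1 - m"
    using assms by (auto simp: m_def field_simps)
  \<comment> \<open>\<open>mD\<close> and \<open>mQ2\<close> record what is left of the first two
    moments of \<open>X1\<close>, taken about \<open>q\<close>, once the atom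
    \<open>(c * \<mu>1, b * \<mu>2)\<close> of mass \<open>1 / b\<close> is removed.\<close>
  have mD: "m * D = m * q - (\<mu>1 - c * \<mu>1 / b)"
    using assms by (simp add: m_def D_def field_simps)
  have mQ2: "m * Q\<^sup>2 = m * q\<^sup>2 - 2 * q * (\<mu>1 - c * \<mu>1 / b) + (a * \<mu>1\<^sup>2 - (c * \<mu>1)\<^sup>2 / b)"
  proof -
    have "m * ((b - c) / (b - 1)) = (b - c) / b" "m * ((a * b - c\<^sup>2) / (b - 1)) = (a * b - c\<^sup>2) / b"
      using assms by (simp_all add: m_def)
    moreover have "m * Q\<^sup>2 = m * q\<^sup>2 - 2 * q * \<mu>1 * (m * ((b - c) / (b - 1)))
        + \<mu>1\<^sup>2 * (m * ((a * b - c\<^sup>2) / (b - 1)))"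
      unfolding Q2 by (simp only: algebra_simps)
    ultimately have "m * Q\<^sup>2 = m * q\<^sup>2 - 2 * q * \<mu>1 * ((b - c) / b) + \<mu>1\<^sup>2 * ((a * b - c\<^sup>2) / b)"
      by (simp only:)
    also have "\<dots> = m * q\<^sup>2 - 2 * q * (\<mu>1 - c * \<mu>1 / b) + (a * \<mu>1\<^sup>2 - (c * \<mu>1)\<^sup>2 / b)"
      using \<open>b > 1\<close> by (simp add: field_simps power2_eq_square)
    finally show ?thesis .
  qed
  have xs: "xs = [((q - Q, 0), m / 2 * (1 + r)), ((q + Q, 0), m / 2 * (1 - r)),
      ((c * \<mu>1, b * \<mu>2), 1 / b)]"
  proof -
    have "q * (b - 1) + \<mu>1 * (c - b) = (b - 1) * D"
      using assms by (simp add: D_def field_simps)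
    then have "(q * (b - 1) + \<mu>1 * (c - b)) / (2 * b * Q) = m / 2 * r"
      by (simp add: m_def r_def)
    moreover have "(b - 1) / (2 * b) = m / 2"
      by (simp add: m_def)
    ultimately show ?thesis
      unfolding xs_def three_point_atoms_def Q_def[symmetric] Let_def
      by (simp only: distrib_left right_diff_distrib mult_1_right)
  qed
  have "0 \<le> m / 2 * (1 + r)" "0 \<le> m / 2 * (1 - r)"
    using m(1) r by (auto intro!: mult_nonneg_nonneg)
  moreover have "m / 2 * (1 + r) + (m / 2 * (1 - r) + 1 / b) = 1"
    unfolding m(2) by (simp add: field_simps)
  ultimately have wf: "pmf_of_list_wf xs"
    using \<open>b > 1\<close> by (auto simp: pmf_of_list_wf_def xs)
  \<comment> \<open>The third atom lies on or below the line \<open>x1 + x2 = q - Q\<close>: its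
    payoff is zero, and the slope \<kappa> chosen below is at least 1.\<close>
  have \<zeta>: "c * \<mu>1 + b * \<mu>2 \<le> q - Q"
    using assms by (simp add: Q_def zeta_b_def)
  have int: "has_bochner_integral (finite_law xs) f y"
    if "f \<in> borel_measurable borel"
      and "f (q - Q, 0) * (m / 2 * (1 + r)) + f (q + Q, 0) * (m / 2 * (1 - r))
        + f (c * \<mu>1, b * \<mu>2) / b = y"
    for f :: "real \<times> real \<Rightarrow> real" and y
    using has_bochner_integral_finite_law[OF wf that(1)] that(2) by (simp add: xs add.assoc)
  \<comment> \<open>In the moments of \<open>X1\<close> below, \<open>r\<close> occurs only in this
    product, which \<open>mD\<close> then evaluates.\<close>
  have mrQ: "m * r * Q = m * D"
    using rQ by (simp add: mult.assoc)
  have mem: "finite_law xs \<in> moment_class (theta \<mu>1 \<mu>2 a b c)"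
  proof -
    have "AE x in finite_law xs. 0 \<le> fst x \<and> 0 \<le> snd x"
    proof (rule AE_finite_law[OF wf])
      show "0 \<le> fst x \<and> 0 \<le> snd x" if "x \<in> fst ` set xs" for x
        using that assms Q0 by (auto simp: xs Q_def)
      show "{x :: real \<times> real. 0 \<le> fst x \<and> 0 \<le> snd x} \<in> sets borel"
        by (intro borel_closed closed_Collect_conj closed_Collect_le continuous_intros)
    qed
    moreover have "has_bochner_integral (finite_law xs) fst \<mu>1"
    proof (rule int)
      have "(q - Q) * (m / 2 * (1 + r)) + (q + Q) * (m / 2 * (1 - r)) + c * \<mu>1 / b
          = m * q - m * r * Q + c * \<mu>1 / b"
        by (simp add: field_simps)
      also have "\<dots> = \<mu>1"
        unfolding mrQ mD by simp
      finally show "fst (q - Q, 0::real) * (m / 2 * (1 + r)) + fst (q + Q, 0::real) * (m / 2 * (1 - r))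
          + fst (c * \<mu>1, b * \<mu>2) / b = \<mu>1"
        unfolding fst_conv .
    qed (simp add: borel_prod[symmetric])
    moreover have "has_bochner_integral (finite_law xs) snd \<mu>2"
      by (rule int) (use assms in \<open>simp_all add: borel_prod[symmetric]\<close>)
    moreover have "has_bochner_integral (finite_law xs) (\<lambda>x. (fst x)\<^sup>2) (a * \<mu>1\<^sup>2)"
    proof (rule int)
      have "(q - Q)\<^sup>2 * (m / 2 * (1 + r)) + (q + Q)\<^sup>2 * (m / 2 * (1 - r)) + (c * \<mu>1)\<^sup>2 / b
          = m * q\<^sup>2 + m * Q\<^sup>2 - 2 * q * (m * r * Q) + (c * \<mu>1)\<^sup>2 / b"
        by (simp add: field_simps power2_eq_square)
      also have "\<dots> = a * \<mu>1\<^sup>2"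
        unfolding mrQ mD mQ2 by (simp add: algebra_simps power2_eq_square)
      finally show "(fst (q - Q, 0::real))\<^sup>2 * (m / 2 * (1 + r))
          + (fst (q + Q, 0::real))\<^sup>2 * (m / 2 * (1 - r)) + (fst (c * \<mu>1, b * \<mu>2))\<^sup>2 / b = a * \<mu>1\<^sup>2"
        unfolding fst_conv .
    qed (simp add: borel_prod[symmetric])
    moreover have "has_bochner_integral (finite_law xs) (\<lambda>x. (snd x)\<^sup>2) (b * \<mu>2\<^sup>2)"
      by (rule int) (use assms in \<open>simp_all add: borel_prod[symmetric] power2_eq_square\<close>)
    moreover have "has_bochner_integral (finite_law xs) (\<lambda>x. fst x * snd x) (c * \<mu>1 * \<mu>2)"
      by (rule int) (use assms in \<open>simp_all add: borel_prod[symmetric]\<close>)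
    ultimately show ?thesis
      by (simp add: moment_class_def theta_def prob_space_finite_law sets_finite_law)
  qed
  have val: "expected_payoff q (finite_law xs) = v"
  proof -
    \<comment> \<open>Only \<open>(q + Q, 0)\<close> can have a positive payoff, namely
      \<open>Q\<close>.\<close>
    have "has_bochner_integral (finite_law xs) (\<lambda>x. max (fst x + snd x - q) 0) (Q * (m / 2 * (1 - r)))"
      by (rule int, simp add: borel_prod[symmetric]) (use \<zeta> Q0 in \<open>simp add: max_def\<close>)
    then have "expected_payoff q (finite_law xs) = Q * (m / 2 * (1 - r))"
      by (simp add: expected_payoff_def has_bochner_integral_iff)
    also have "\<dots> = v"
      by (simp add: v_def rQ[symmetric] algebra_simps)
    finally show ?thesis .
  qed
  have le: "expected_payoff q P \<le> v" if P: "P \<in> moment_class (theta \<mu>1 \<mu>2 a b c)" for P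
  proof -
    \<comment> \<open>This slope makes \<open>Z = - Q\<close> at the third atom; on the other two
      atoms \<open>Z\<close> is \<open>- Q\<close> and \<open>Q\<close> for every slope.\<close>
    define \<kappa> where "\<kappa> = (q - Q - c * \<mu>1) / (b * \<mu>2)"
    have \<kappa>: "\<kappa> \<ge> 1"
      using \<zeta> assms by (simp add: \<kappa>_def le_divide_eq)
    have \<kappa>\<mu>2: "\<kappa> * \<mu>2 = (q - Q - c * \<mu>1) / b"
      using assms by (simp add: \<kappa>_def)
    have "a * \<mu>1\<^sup>2 + \<kappa>\<^sup>2 * (b * \<mu>2\<^sup>2) + 2 * \<kappa> * (c * \<mu>1 * \<mu>2) - 2 * q * (\<mu>1 + \<kappa> * \<mu>2) + q\<^sup>2
        = a * \<mu>1\<^sup>2 + b * (\<kappa> * \<mu>2)\<^sup>2 + 2 * c * \<mu>1 * (\<kappa> * \<mu>2) - 2 * q * (\<mu>1 + \<kappa> * \<mu>2) + q\<^sup>2"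
      by (simp add: power_mult_distrib)
    \<comment> \<open>E[Z^2] depends on the moments alone, so it is the one of the three-point law:
      \<open>Q\<^sup>2\<close> on the axis of mass \<open>m\<close> and at the third atom of mass
      \<open>1 / b\<close>.\<close>
    also have "\<dots> = m * Q\<^sup>2 + Q\<^sup>2 / b"
      unfolding \<kappa>\<mu>2 mQ2 using assms by (simp add: m_def field_simps power2_eq_square)
    also have "\<dots> = Q\<^sup>2"
      using assms by (simp add: m_def field_simps)
    finally have second_moment: "a * \<mu>1\<^sup>2 + \<kappa>\<^sup>2 * (b * \<mu>2\<^sup>2) + 2 * \<kappa> * (c * \<mu>1 * \<mu>2)
        - 2 * q * (\<mu>1 + \<kappa> * \<mu>2) + q\<^sup>2 = Q\<^sup>2" .
    have "expected_payoff q P \<le> (\<mu>1 + \<kappa> * \<mu>2 - q + Q) / 2"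
      using expected_payoff_le[OF P[unfolded theta_def] \<kappa>, of q] Q0
      unfolding second_moment by simp
    also have "\<dots> = v"
      unfolding \<kappa>\<mu>2 v_def right_diff_distrib using assms mD
      by (simp add: m_def field_simps)
    finally show ?thesis .
  qed
  have sup: "v_P q (theta \<mu>1 \<mu>2 a b c) = ereal v"
    unfolding v_P_def
  proof (rule antisym)
    show "(SUP P\<in>moment_class (theta \<mu>1 \<mu>2 a b c). ereal (expected_payoff q P)) \<le> ereal v"
      using le by (intro SUP_least) simp
    show "ereal v \<le> (SUP P\<in>moment_class (theta \<mu>1 \<mu>2 a b c). ereal (expected_payoff q P))"
      using SUP_upper[OF mem, of "\<lambda>P. ereal (expected_payoff q P)"] by (simp add: val)
  qed
  have "v = (b - 1) / (2 * b) * ((b - c) / (b - 1) * \<mu>1 - (q - Q_b q \<mu>1 a b c))"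
    by (simp add: v_def m_def D_def Q_def diff_diff_eq2 add.commute mult.commute)
  then show ?thesis
    using wf mem val sup by (simp add: optimal_distribution_def xs_def)
qed

end
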